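(* Let $K$ be an algebraically closed field and let $A=KQ/I$ be a special multiserial algebra with $I=\langle\rho\rangle$ admissible, such that condition (S) holds for $KQ/I$. Let $r=\sum\lambda_p p\in\rho$ be uniform, where the sum is over paths $p$ in $Q$, $\lambda_p\in K$, and almost all $\lambda_p=0$. Then either $r$ is a path, or for every $p$ with $\lambda_p\neq 0$, $p$ lies in the socle of $A$ both as a right $A$-module and as a left $A$-module.
   Context: A quiver $Q=(Q_0,Q_1,s,e)$ has a finite set of vertices $Q_0$, a finite set of arrows $Q_1$, and maps $s,e:Q_1\to Q_0$ giving the start and end of each arrow. Paths are composed left to right: for arrows $a,b$ with $e(a)=s(b)$, $ab$ denotes the path "first $a$, then $b$" in the path algebra $KQ$ (and $ab=0$ in $KQ$ if $e(a)\neq s(b)$). For $v\in Q_0$, $e_v$ is the associated idempotent. An element $x\in KQ$ is uniform if there exist $v,w\in Q_0$ with $e_v x e_w=x$. Condition (S) for $KQ/I$: for every $a\in Q_1$ there is at most one arrow $b\in Q_1$ such that $ab\notin I$, and at most one arrow $c\in Q_1$ such that $ca\notin I$. A finite dimensional $K$-algebra is special multiserial if it is Morita equivalent to an algebra $KQ/I$ ($I$ admissible) for which (S) holds. Here $\rho$ is a set of relations generating the ideal $I$. Saying that a path $p$ lies in the socle of $A$ means that its residue class in $A=KQ/I$ does. *)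

theory Defs
  imports
    "HOL-Library.Poly_Mapping"
    "HOL-Computational_Algebra.Polynomial"
    "HOL-Algebra.Ideal_Product"
    "HOL-Algebra.QuotRing"
    "HOL-Algebra.Generated_Groups"
    "Graph_Theory.Arc_Walk"
begin

section \<open>Quivers and path algebras\<close>

text \<open>
  A quiver is a \<^locale>\<open>fin_digraph\<close>, that is, a finite directed multigraph with loops allowed;
  \<^const>\<open>tail\<close> is the start map and \<^const>\<open>head\<close> the end map. A path is stored with both
  endpoints, as (start, list of arrows, end). The arrows are listed in the order in which they are
  traversed, so that juxtaposition is composition from left to right, and \<open>(v, [], v)\<close> is the
  trivial path at \<open>v\<close>. Vertices and arrows may be repeated along a path.
\<close>

type_synonym ('v, 'a) qpath = "'v \<times> 'a list \<times> 'v"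

definition qpaths :: "('v, 'a) pre_digraph \<Rightarrow> ('v, 'a) qpath set" where
  "qpaths Q = {(u, as, v). pre_digraph.awalk Q u as v}"

definition qsource :: "('v, 'a) qpath \<Rightarrow> 'v" where
  "qsource p = fst p"

definition qtarget :: "('v, 'a) qpath \<Rightarrow> 'v" where
  "qtarget p = snd (snd p)"

definition qconcat :: "('v, 'a) qpath \<Rightarrow> ('v, 'a) qpath \<Rightarrow> ('v, 'a) qpath" where
  "qconcat p q = (qsource p, fst (snd p) @ fst (snd q), qtarget q)"

text \<open>
  An element of the path algebra is a finitely supported family of coefficients indexed by paths:
  the coefficient \<open>\<lambda>\<^sub>p\<close> of \<open>x = \<Sum>\<lambda>\<^sub>p p\<close> is \<^term>\<open>Poly_Mapping.lookup x p\<close>.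
\<close>

definition pa_mult ::
  "(('v, 'a) qpath \<Rightarrow>\<^sub>0 'k::field) \<Rightarrow> (('v, 'a) qpath \<Rightarrow>\<^sub>0 'k) \<Rightarrow> (('v, 'a) qpath \<Rightarrow>\<^sub>0 'k)" where
  "pa_mult f g =
     (\<Sum>p\<in>Poly_Mapping.keys f. \<Sum>q\<in>Poly_Mapping.keys g.
        if qtarget p = qsource q
        then Poly_Mapping.single (qconcat p q) (Poly_Mapping.lookup f p * Poly_Mapping.lookup g q)
        else 0)"

definition path_elt :: "('v, 'a) qpath \<Rightarrow> (('v, 'a) qpath \<Rightarrow>\<^sub>0 'k::field)" where
  "path_elt p = Poly_Mapping.single p 1"

definition idem_elt :: "'v \<Rightarrow> (('v, 'a) qpath \<Rightarrow>\<^sub>0 'k::field)" where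
  "idem_elt v = path_elt (v, [], v)"

definition arrow_elt ::
  "('v, 'a) pre_digraph \<Rightarrow> 'a \<Rightarrow> (('v, 'a) qpath \<Rightarrow>\<^sub>0 'k::field)" where
  "arrow_elt Q a = path_elt (tail Q a, [a], head Q a)"

definition path_algebra :: "('v, 'a) pre_digraph \<Rightarrow> (('v, 'a) qpath \<Rightarrow>\<^sub>0 'k::field) ring" where
  "path_algebra Q =
     \<lparr> carrier = {f. Poly_Mapping.keys f \<subseteq> qpaths Q},
       mult = pa_mult,
       one = (\<Sum>v\<in>verts Q. idem_elt v),
       zero = 0,
       add = (+) \<rparr>"

definition uniform_elt :: "('v, 'a) pre_digraph \<Rightarrow> (('v, 'a) qpath \<Rightarrow>\<^sub>0 'k::field) \<Rightarrow> bool" where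
  "uniform_elt Q x \<longleftrightarrow>
     (\<exists>v\<in>verts Q. \<exists>w\<in>verts Q.
        idem_elt v \<otimes>\<^bsub>path_algebra Q\<^esub> x \<otimes>\<^bsub>path_algebra Q\<^esub> idem_elt w = x)"

section \<open>Admissible ideals and condition (S)\<close>

definition arrow_ideal :: "('v, 'a) pre_digraph \<Rightarrow> (('v, 'a) qpath \<Rightarrow>\<^sub>0 'k::field) set" where
  "arrow_ideal Q = genideal (path_algebra Q) (arrow_elt Q ` arcs Q)"

text \<open>Powers of an ideal \<open>J\<close> of \<open>R\<close> are its powers in the multiplicative monoid of ideals of \<open>R\<close>.\<close>

definition admissible ::
  "('v, 'a) pre_digraph \<Rightarrow> (('v, 'a) qpath \<Rightarrow>\<^sub>0 'k::field) set \<Rightarrow> bool" where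
  "admissible Q I \<longleftrightarrow>
     ideal I (path_algebra Q) \<and>
     I \<subseteq> arrow_ideal Q [^]\<^bsub>ideals_set (path_algebra Q)\<^esub> (2::nat) \<and>
     (\<exists>m::nat. m \<ge> 2 \<and> arrow_ideal Q [^]\<^bsub>ideals_set (path_algebra Q)\<^esub> m \<subseteq> I)"

text \<open>
  For admissible \<open>I\<close> the quotient \<open>KQ/I\<close> is finite dimensional, so condition (S) for
  \<open>I\<close> already makes \<open>KQ/I\<close> a special multiserial algebra, being Morita equivalent to itself.
  Arrows that cannot be composed have product \<open>0\<close>, which lies in \<open>I\<close>.
\<close>

definition condition_S ::
  "('v, 'a) pre_digraph \<Rightarrow> (('v, 'a) qpath \<Rightarrow>\<^sub>0 'k::field) set \<Rightarrow> bool" where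
  "condition_S Q I \<longleftrightarrow>
     (\<forall>a\<in>arcs Q.
        (\<exists>\<^sub>\<le>\<^sub>1 b. b \<in> arcs Q \<and> arrow_elt Q a \<otimes>\<^bsub>path_algebra Q\<^esub> arrow_elt Q b \<notin> I) \<and>
        (\<exists>\<^sub>\<le>\<^sub>1 c. c \<in> arcs Q \<and> arrow_elt Q c \<otimes>\<^bsub>path_algebra Q\<^esub> arrow_elt Q a \<notin> I))"

section \<open>Socles of the regular modules\<close>

text \<open>
  The submodules of a ring, regarded as a right (left) module over itself, are its right (left)
  ideals. When the ring is a unital algebra over a field, these are automatically linear subspaces.
  The socle is the sum of all simple submodules, i.e. the additive subgroup which they generate.
\<close>

definition right_submodule :: "'b set \<Rightarrow> ('b, 'c) ring_scheme \<Rightarrow> bool" where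
  "right_submodule M R \<longleftrightarrow>
     additive_subgroup M R \<and> (\<forall>m\<in>M. \<forall>x\<in>carrier R. m \<otimes>\<^bsub>R\<^esub> x \<in> M)"

definition left_submodule :: "'b set \<Rightarrow> ('b, 'c) ring_scheme \<Rightarrow> bool" where
  "left_submodule M R \<longleftrightarrow>
     additive_subgroup M R \<and> (\<forall>m\<in>M. \<forall>x\<in>carrier R. x \<otimes>\<^bsub>R\<^esub> m \<in> M)"

definition simple_right_submodule :: "'b set \<Rightarrow> ('b, 'c) ring_scheme \<Rightarrow> bool" where
  "simple_right_submodule M R \<longleftrightarrow>
     right_submodule M R \<and> M \<noteq> {\<zero>\<^bsub>R\<^esub>} \<and>
     (\<forall>N. right_submodule N R \<and> N \<subseteq> M \<longrightarrow> N = {\<zero>\<^bsub>R\<^esub>} \<or> N = M)"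

definition simple_left_submodule :: "'b set \<Rightarrow> ('b, 'c) ring_scheme \<Rightarrow> bool" where
  "simple_left_submodule M R \<longleftrightarrow>
     left_submodule M R \<and> M \<noteq> {\<zero>\<^bsub>R\<^esub>} \<and>
     (\<forall>N. left_submodule N R \<and> N \<subseteq> M \<longrightarrow> N = {\<zero>\<^bsub>R\<^esub>} \<or> N = M)"

definition right_socle :: "('b, 'c) ring_scheme \<Rightarrow> 'b set" where
  "right_socle R = generate (add_monoid R) (\<Union>{M. simple_right_submodule M R})"

definition left_socle :: "('b, 'c) ring_scheme \<Rightarrow> 'b set" where
  "left_socle R = generate (add_monoid R) (\<Union>{M. simple_left_submodule M R})"

section \<open>The path algebra is a ring\<close>

lemma pa_mult_superset:
  assumes "finite P" "Poly_Mapping.keys f \<subseteq> P" "finite P'" "Poly_Mapping.keys g \<subseteq> P'"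
  shows "pa_mult f g =
     (\<Sum>p\<in>P. \<Sum>q\<in>P'.
        if qtarget p = qsource q
        then Poly_Mapping.single (qconcat p q) (Poly_Mapping.lookup f p * Poly_Mapping.lookup g q)
        else 0)"
proof -
  let ?h = "\<lambda>p q. if qtarget p = qsource q
        then Poly_Mapping.single (qconcat p q) (Poly_Mapping.lookup f p * Poly_Mapping.lookup g q)
        else 0"
  have "(\<Sum>q\<in>Poly_Mapping.keys g. ?h p q) = (\<Sum>q\<in>P'. ?h p q)" for p
    by (rule sum.mono_neutral_left) (use assms in \<open>auto simp: in_keys_iff\<close>)
  then have "pa_mult f g = (\<Sum>p\<in>Poly_Mapping.keys f. \<Sum>q\<in>P'. ?h p q)"
    by (simp add: pa_mult_def)
  also have "\<dots> = (\<Sum>p\<in>P. \<Sum>q\<in>P'. ?h p q)"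
    by (rule sum.mono_neutral_left) (use assms in \<open>auto simp: in_keys_iff intro!: sum.neutral\<close>)
  finally show ?thesis .
qed

lemma pa_mult_add_left: "pa_mult (f + g) h = pa_mult f h + pa_mult g h"
proof -
  let ?P = "Poly_Mapping.keys f \<union> Poly_Mapping.keys g"
  have *: "finite ?P" "Poly_Mapping.keys f \<subseteq> ?P" "Poly_Mapping.keys g \<subseteq> ?P"
    "Poly_Mapping.keys (f + g) \<subseteq> ?P"
    by (auto dest: keys_add[THEN subsetD])
  show ?thesis
    unfolding pa_mult_superset[OF *(1,2) finite_keys subset_refl]
      pa_mult_superset[OF *(1,3) finite_keys subset_refl]
      pa_mult_superset[OF *(1,4) finite_keys subset_refl] sum.distrib[symmetric]
    by (intro sum.cong) (auto simp: lookup_add algebra_simps single_add)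
qed

lemma pa_mult_add_right: "pa_mult h (f + g) = pa_mult h f + pa_mult h g"
proof -
  let ?P = "Poly_Mapping.keys f \<union> Poly_Mapping.keys g"
  have *: "finite ?P" "Poly_Mapping.keys f \<subseteq> ?P" "Poly_Mapping.keys g \<subseteq> ?P"
    "Poly_Mapping.keys (f + g) \<subseteq> ?P"
    by (auto dest: keys_add[THEN subsetD])
  show ?thesis
    unfolding pa_mult_superset[OF finite_keys subset_refl *(1,2)]
      pa_mult_superset[OF finite_keys subset_refl *(1,3)]
      pa_mult_superset[OF finite_keys subset_refl *(1,4)] sum.distrib[symmetric]
    by (intro sum.cong) (auto simp: lookup_add algebra_simps single_add)
qed

lemma pa_mult_zero [simp]: "pa_mult 0 f = 0" "pa_mult f 0 = 0"
  by (simp_all add: pa_mult_def)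

lemma pa_mult_sum_left: "pa_mult (\<Sum>i\<in>X. f i) g = (\<Sum>i\<in>X. pa_mult (f i) g)"
  by (induction X rule: infinite_finite_induct) (auto simp: pa_mult_add_left)

lemma pa_mult_sum_right: "pa_mult g (\<Sum>i\<in>X. f i) = (\<Sum>i\<in>X. pa_mult g (f i))"
  by (induction X rule: infinite_finite_induct) (auto simp: pa_mult_add_right)

lemma pa_mult_single:
  "pa_mult (Poly_Mapping.single p c) (Poly_Mapping.single q d) =
     (if qtarget p = qsource q then Poly_Mapping.single (qconcat p q) (c * d) else 0)"
  by (subst pa_mult_superset[of "{p}" _ "{q}"]) auto

lemma sum_single_lookup:
  "(\<Sum>p\<in>Poly_Mapping.keys f. Poly_Mapping.single p (Poly_Mapping.lookup f p)) = f"
  by (rule poly_mapping_eqI)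
    (auto simp: lookup_sum lookup_single when_def sum.delta in_keys_iff)

lemma pa_mult_assoc:
  fixes f g h :: "('v, 'a) qpath \<Rightarrow>\<^sub>0 'k::field"
  shows "pa_mult (pa_mult f g) h = pa_mult f (pa_mult g h)"
proof -
  have single: "pa_mult (pa_mult (Poly_Mapping.single p c) (Poly_Mapping.single q d))
      (Poly_Mapping.single s e) =
    pa_mult (Poly_Mapping.single p c)
      (pa_mult (Poly_Mapping.single q d) (Poly_Mapping.single s e))"
    for p q s :: "('v, 'a) qpath" and c d e :: 'k
    by (auto simp: pa_mult_single qconcat_def qsource_def qtarget_def mult.assoc)
  let ?S = "\<lambda>f. \<Sum>p\<in>Poly_Mapping.keys f. Poly_Mapping.single p (Poly_Mapping.lookup f p)"
  have "pa_mult (pa_mult (?S f) (?S g)) (?S h) = pa_mult (?S f) (pa_mult (?S g) (?S h))"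
    by (simp only: pa_mult_sum_left pa_mult_sum_right single)
  then show ?thesis
    by (simp add: sum_single_lookup)
qed

lemma qpath_ends:
  assumes "fin_digraph Q" "p \<in> qpaths Q"
  shows "qsource p \<in> verts Q" "qtarget p \<in> verts Q"
proof -
  interpret fin_digraph Q by fact
  show "qsource p \<in> verts Q" "qtarget p \<in> verts Q"
    using assms(2) by (auto simp: qpaths_def qsource_def qtarget_def)
qed

lemma qconcat_in_qpaths:
  assumes "fin_digraph Q" "p \<in> qpaths Q" "q \<in> qpaths Q" "qtarget p = qsource q"
  shows "qconcat p q \<in> qpaths Q"
proof -
  interpret fin_digraph Q by fact
  show ?thesis
    using assms(2-4) by (auto simp: qpaths_def qsource_def qtarget_def qconcat_def)
qed

lemma path_algebra_one:
  fixes f :: "('v, 'a) qpath \<Rightarrow>\<^sub>0 'k::field"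
  assumes "fin_digraph Q" "Poly_Mapping.keys f \<subseteq> qpaths Q"
  shows "pa_mult (\<Sum>v\<in>verts Q. idem_elt v) f = f" "pa_mult f (\<Sum>v\<in>verts Q. idem_elt v) = f"
proof -
  interpret fin_digraph Q by fact
  let ?s = "\<lambda>p. Poly_Mapping.single p (Poly_Mapping.lookup f p)"
  have eq: "pa_mult (idem_elt v) (?s p) = (if qsource p = v then ?s p else 0)"
    "pa_mult (?s p) (idem_elt v) = (if qtarget p = v then ?s p else 0)" for v p
    by (auto simp: idem_elt_def path_elt_def pa_mult_single qconcat_def qsource_def qtarget_def)
  have "pa_mult (\<Sum>v\<in>verts Q. idem_elt v) (?s p) = ?s p"
    "pa_mult (?s p) (\<Sum>v\<in>verts Q. idem_elt v) = ?s p" if "p \<in> Poly_Mapping.keys f" for p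
    using that assms qpath_ends[OF assms(1), of p]
    by (auto simp: pa_mult_sum_left pa_mult_sum_right eq)
  then have "pa_mult (\<Sum>v\<in>verts Q. idem_elt v) (\<Sum>p\<in>Poly_Mapping.keys f. ?s p)
      = (\<Sum>p\<in>Poly_Mapping.keys f. ?s p)"
    "pa_mult (\<Sum>p\<in>Poly_Mapping.keys f. ?s p) (\<Sum>v\<in>verts Q. idem_elt v)
      = (\<Sum>p\<in>Poly_Mapping.keys f. ?s p)"
    by (simp_all add: pa_mult_sum_right[of _ _ "Poly_Mapping.keys f"]
        pa_mult_sum_left[of _ "Poly_Mapping.keys f"])
  then show "pa_mult (\<Sum>v\<in>verts Q. idem_elt v) f = f" "pa_mult f (\<Sum>v\<in>verts Q. idem_elt v) = f"
    by (simp_all add: sum_single_lookup)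
qed

lemma keys_sum_subset:
  assumes "\<And>i. i \<in> X \<Longrightarrow> Poly_Mapping.keys (f i) \<subseteq> Y"
  shows "Poly_Mapping.keys (\<Sum>i\<in>X. f i) \<subseteq> Y"
  using assms
  by (induction X rule: infinite_finite_induct) (auto dest!: keys_add[THEN subsetD])

lemma ring_path_algebra:
  assumes "fin_digraph Q"
  shows "ring (path_algebra Q :: (('v, 'a) qpath \<Rightarrow>\<^sub>0 'k::field) ring)"
proof (rule ringI)
  interpret fin_digraph Q by fact
  let ?R = "path_algebra Q :: (('v, 'a) qpath \<Rightarrow>\<^sub>0 'k) ring"
  show "abelian_group ?R"
  proof (rule abelian_groupI)
    fix x assume "x \<in> carrier ?R"
    then show "\<exists>y\<in>carrier ?R. y \<oplus>\<^bsub>?R\<^esub> x = \<zero>\<^bsub>?R\<^esub>"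
      by (intro bexI[of _ "- x"]) (auto simp: path_algebra_def in_keys_iff)
  qed (auto simp: path_algebra_def algebra_simps dest!: keys_add[THEN subsetD])
  show "Group.monoid ?R"
  proof (rule Group.monoidI)
    have "Poly_Mapping.keys (\<Sum>v\<in>verts Q. idem_elt v :: ('v, 'a) qpath \<Rightarrow>\<^sub>0 'k) \<subseteq> qpaths Q"
      by (intro keys_sum_subset) (auto simp: idem_elt_def path_elt_def qpaths_def awalk_Nil_iff)
    then show "\<one>\<^bsub>?R\<^esub> \<in> carrier ?R"
      by (simp add: path_algebra_def)
  next
    fix x y assume "x \<in> carrier ?R" "y \<in> carrier ?R"
    then have "Poly_Mapping.keys (pa_mult x y) \<subseteq> qpaths Q"
      unfolding pa_mult_def
      by (intro keys_sum_subset)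
        (auto simp: path_algebra_def split: if_splits intro: qconcat_in_qpaths[OF assms])
    then show "x \<otimes>\<^bsub>?R\<^esub> y \<in> carrier ?R"
      by (simp add: path_algebra_def)
  qed (auto simp: path_algebra_def pa_mult_assoc path_algebra_one[OF assms])
qed (auto simp: path_algebra_def pa_mult_add_left pa_mult_add_right)

end

theory Submission
  imports Defs
begin

text \<open>
  Call a path alive if it does not lie in \<open>I\<close>. By condition (S), two alive paths with the same last
  arrow are suffixes of one another. Suppose \<open>q a\<close> is alive for some \<open>q\<close> in the support of \<open>r\<close> and
  some arrow \<open>a\<close>, choose such a \<open>q\<close> of minimal length, and a longest path \<open>u\<close> for which \<open>u q a\<close> is
  still alive. Any other \<open>q'\<close> in the support with \<open>u q' a\<close> alive would be a proper left extension of
  \<open>q\<close>, contradicting the choice of \<open>u\<close>. So \<open>u r a \<in> I\<close> leaves only \<open>u q a \<in> I\<close>, which is absurd.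
  Hence every path in the support is annihilated by the arrows on the right and, dually, on the
  left, and spans a module which is zero or simple.
\<close>

section \<open>Factorial languages\<close>

text \<open>Words carry neither endpoints nor coefficients here, which keeps the combinatorics apart
  from the algebra; \<open>P\<close> is instantiated with \<open>alive\<close> later.\<close>

definition factorial :: "('a list \<Rightarrow> bool) \<Rightarrow> bool" where
  "factorial P \<longleftrightarrow> (\<forall>xs ys zs. P (xs @ ys @ zs) \<longrightarrow> P ys)"

lemma factorialD:
  assumes "factorial P" "P (xs @ ys @ zs)"
  shows "P ys"
  using assms(1)[unfolded factorial_def, THEN spec, THEN spec, THEN spec, THEN mp, OF assms(2)] .

text \<open>All two-letter factors of both words satisfy \<open>P\<close>, so \<open>pred\<close>
  determines each letter from its right neighbour. Read leftwards from the common last letter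
  \<open>a\<close>, the words agree until the shorter one is used up.\<close>

lemma suffix_comparable:
  assumes factor: "factorial P"
    and pred: "\<forall>a b c. P [a, c] \<longrightarrow> P [b, c] \<longrightarrow> a = b"
    and "P (xs @ [a])" "P (ys @ [a])" "length xs \<le> length ys"
  shows "\<exists>zs. ys = zs @ xs"
  using assms(3-5)
proof (induction xs arbitrary: ys)
  case Nil
  then show ?case by simp
next
  case (Cons x xs)
  have "P (xs @ [a])"
    using factorialD[OF factor, of "[x]" "xs @ [a]" "[]"] Cons.prems by simp
  then obtain zs where zs: "ys = zs @ xs"
    using Cons.IH[of ys] Cons.prems by auto
  then obtain zs' z where zs': "zs = zs' @ [z]"
    using Cons.prems(3) by (cases zs rule: rev_cases) auto
  \<comment> \<open>\<open>h\<close> is the letter right after \<open>x\<close>, namely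
    \<open>a\<close> if \<open>xs\<close> is empty; naming it treats both cases at once.\<close>
  obtain h t where h: "xs @ [a] = h # t"
    by (cases "xs @ [a]") auto
  have "P [z, h]"
    using factorialD[OF factor, of zs' "[z, h]" t] Cons.prems(2) zs zs' h by simp
  moreover have "P [x, h]"
    using factorialD[OF factor, of "[]" "[x, h]" t] Cons.prems(1) h by simp
  ultimately have "z = x"
    using pred by blast
  then show ?case
    using zs zs' by simp
qed

text \<open>Minimality of \<open>q\<close> makes every competitor \<open>q'\<close> a left extension
  of \<open>q\<close>, and maximality of \<open>us\<close> leaves no room for the additional
  letters.\<close>

lemma isolating_left_extension:
  assumes factor: "factorial P"
    and pred: "\<forall>a b c. P [a, c] \<longrightarrow> P [b, c] \<longrightarrow> a = b"
    and bound: "\<forall>xs. P xs \<longrightarrow> length xs < m"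
    and p: "p \<in> S" "P (p @ [a])"
  shows "\<exists>q\<in>S. \<exists>us. P (us @ q @ [a]) \<and> (\<forall>q'\<in>S. P (us @ q' @ [a]) \<longrightarrow> q' = q)"
proof -
  obtain q where q: "q \<in> S" "P (q @ [a])"
    and q_min: "\<And>q'. q' \<in> S \<Longrightarrow> P (q' @ [a]) \<Longrightarrow> length q \<le> length q'"
    using ex_has_least_nat[of "\<lambda>q. q \<in> S \<and> P (q @ [a])" p length] p by auto
  have "\<exists>us. P (us @ q @ [a]) \<and> (\<forall>us'. P (us' @ q @ [a]) \<longrightarrow> length us' \<le> length us)"
  \<comment> \<open>The empty word is one such extension and all lengths are below \<open>m\<close>,
    so a longest extension exists.\<close>
  proof (rule ex_has_greatest_nat[of _ "[]" _ m])
    show "P ([] @ q @ [a])"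
      using q(2) by simp
    show "\<forall>us. P (us @ q @ [a]) \<longrightarrow> length us < m"
      using bound by fastforce
  qed
  then obtain us where us: "P (us @ q @ [a])"
    and us_max: "\<And>us'. P (us' @ q @ [a]) \<Longrightarrow> length us' \<le> length us"
    by blast
  have "q' = q" if q': "q' \<in> S" "P (us @ q' @ [a])" for q'
  proof -
    have "P (q' @ [a])"
      using factorialD[OF factor, of us "q' @ [a]" "[]"] q'(2) by simp
    then obtain zs where zs: "q' = zs @ q"
      using suffix_comparable[OF factor pred q(2), of q'] q_min[of q'] q'(1) by blast
    with us_max[of "us @ zs"] q'(2) show ?thesis
      by simp
  qed
  with q(1) us show ?thesis
    by blast
qed

text \<open>Reversal of words turns \<open>succ\<close> into the predecessor condition and right
  extensions into left ones, which reduces the claim to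
  \<open>isolating_left_extension\<close>.\<close>

lemma isolating_right_extension:
  assumes factor: "factorial P"
    and succ: "\<forall>a b c. P [c, a] \<longrightarrow> P [c, b] \<longrightarrow> a = b"
    and bound: "\<forall>xs. P xs \<longrightarrow> length xs < m"
    and p: "p \<in> S" "P (a # p)"
  shows "\<exists>q\<in>S. \<exists>us. P (a # q @ us) \<and> (\<forall>q'\<in>S. P (a # q' @ us) \<longrightarrow> q' = q)"
proof -
  have "factorial (\<lambda>xs. P (rev xs))"
    unfolding factorial_def
  proof (intro allI impI)
    fix xs ys zs assume "P (rev (xs @ ys @ zs))"
    then show "P (rev ys)"
      using factorialD[OF factor, of "rev zs" "rev ys" "rev xs"] by simp
  qed
  moreover have "\<forall>b c d. P (rev [b, d]) \<longrightarrow> P (rev [c, d]) \<longrightarrow> b = c"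
    using succ by simp
  moreover have "\<forall>xs. P (rev xs) \<longrightarrow> length xs < m"
    using bound by fastforce
  moreover have "rev p \<in> rev ` S" "P (rev (rev p @ [a]))"
    using p by auto
  ultimately have "\<exists>q\<in>rev ` S. \<exists>us. P (rev (us @ q @ [a])) \<and>
      (\<forall>q'\<in>rev ` S. P (rev (us @ q' @ [a])) \<longrightarrow> q' = q)"
    by (rule isolating_left_extension[of "\<lambda>xs. P (rev xs)"])
  then obtain q us where "q \<in> S" "P (a # q @ rev us)"
    "\<forall>q'\<in>S. P (a # q' @ rev us) \<longrightarrow> q' = q"
    by auto
  then show ?thesis
    by blast
qed

section \<open>Ideals of path algebras\<close>

lemma path_algebra_simps [simp]:
  "f \<in> carrier (path_algebra Q) \<longleftrightarrow> Poly_Mapping.keys f \<subseteq> qpaths Q"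
  "f \<otimes>\<^bsub>path_algebra Q\<^esub> g = pa_mult f g"
  "f \<oplus>\<^bsub>path_algebra Q\<^esub> g = f + g"
  "\<zero>\<^bsub>path_algebra Q\<^esub> = 0"
  by (simp_all add: path_algebra_def)

lemma path_algebra_a_inv:
  assumes "fin_digraph Q" "Poly_Mapping.keys f \<subseteq> qpaths Q"
  shows "\<ominus>\<^bsub>path_algebra Q\<^esub> f = - f"
proof -
  interpret ring "path_algebra Q"
    using assms(1) by (rule ring_path_algebra)
  show ?thesis
    using minus_equality[of "- f" f] assms(2) by simp
qed

lemma qpath_cases:
  assumes "fin_digraph Q" "(u, as, v) \<in> qpaths Q"
  obtains (trivial) "as = []" "v = u" |
    (arrow) a as' where "as = a # as'" "a \<in> arcs Q" "tail Q a = u" "(head Q a, as', v) \<in> qpaths Q"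
proof -
  interpret fin_digraph Q by fact
  show ?thesis
    using that assms(2) by (cases as) (auto simp: qpaths_def awalk_simps)
qed

lemma qpath_rev_cases:
  assumes "fin_digraph Q" "(u, as, v) \<in> qpaths Q"
  obtains (trivial) "as = []" "v = u" |
    (arrow) a as' where "as = as' @ [a]" "a \<in> arcs Q" "head Q a = v" "(u, as', tail Q a) \<in> qpaths Q"
proof -
  interpret fin_digraph Q by fact
  show ?thesis
    using that assms(2) by (cases as rule: rev_cases) (auto simp: qpaths_def awalk_simps)
qed

lemma qpaths_append_iff:
  assumes "fin_digraph Q"
  shows "(u, as @ bs, v) \<in> qpaths Q \<longleftrightarrow> (\<exists>w. (u, as, w) \<in> qpaths Q \<and> (w, bs, v) \<in> qpaths Q)"
proof -
  interpret fin_digraph Q by fact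
  show ?thesis
    by (auto simp: qpaths_def)
qed

lemma qpaths_arrow_iff:
  assumes "fin_digraph Q"
  shows "(u, [a], v) \<in> qpaths Q \<longleftrightarrow> a \<in> arcs Q \<and> u = tail Q a \<and> v = head Q a"
proof -
  interpret fin_digraph Q by fact
  show ?thesis
    by (auto simp: qpaths_def awalk_simps)
qed

text \<open>Multiplication by \<open>idem_elt v\<close> on the left keeps only paths starting at
  \<open>v\<close>, multiplication by \<open>idem_elt w\<close> on the right only those ending at
  \<open>w\<close>, and \<open>r\<close> equals the product.\<close>

lemma uniform_elt_keys:
  assumes "uniform_elt Q r"
  obtains v w where "\<And>p. p \<in> Poly_Mapping.keys r \<Longrightarrow> qsource p = v \<and> qtarget p = w"
proof -
  obtain v w where "pa_mult (pa_mult (idem_elt v) r) (idem_elt w) = r"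
    using assms by (auto simp: uniform_elt_def)
  moreover have "Poly_Mapping.keys (pa_mult (pa_mult (idem_elt v) r) (idem_elt w))
      \<subseteq> {p. qsource p = v \<and> qtarget p = w}"
  proof -
    have "Poly_Mapping.keys (pa_mult (idem_elt v) r) \<subseteq> {p. qsource p = v}"
      unfolding pa_mult_def
      by (intro keys_sum_subset)
        (auto simp: idem_elt_def path_elt_def qconcat_def qsource_def split: if_splits)
    then show ?thesis
      unfolding pa_mult_def[of _ "idem_elt w"]
      by (intro keys_sum_subset)
        (auto simp: idem_elt_def path_elt_def qconcat_def qsource_def qtarget_def split: if_splits)
  qed
  ultimately show ?thesis
    by (intro that[of v w]) auto
qed

section \<open>Closure properties of the ideal and isolation of a single term\<close>

locale path_algebra_ideal = fin_digraph Q + J: ideal I "path_algebra Q"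
  for Q :: "('v, 'a) pre_digraph" and I :: "(('v, 'a) qpath \<Rightarrow>\<^sub>0 'k::field) set"
begin

lemma ideal_mult_left:
  "Poly_Mapping.keys f \<subseteq> qpaths Q \<Longrightarrow> g \<in> I \<Longrightarrow> pa_mult f g \<in> I"
  using J.I_l_closed[of g f] by simp

lemma ideal_mult_right:
  "Poly_Mapping.keys f \<subseteq> qpaths Q \<Longrightarrow> g \<in> I \<Longrightarrow> pa_mult g f \<in> I"
  using J.I_r_closed[of g f] by simp

lemma ideal_zero: "0 \<in> I"
  using additive_subgroup.zero_closed[OF J.is_additive_subgroup] by simp

lemma ideal_add: "f \<in> I \<Longrightarrow> g \<in> I \<Longrightarrow> f + g \<in> I"
  using additive_subgroup.a_closed[OF J.is_additive_subgroup, of f g] by simp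

lemma ideal_keys: "f \<in> I \<Longrightarrow> Poly_Mapping.keys f \<subseteq> qpaths Q"
  using J.a_Hcarr[of f] by simp

lemma ideal_uminus: "f \<in> I \<Longrightarrow> - f \<in> I"
  using additive_subgroup.a_inv_closed[OF J.is_additive_subgroup, of f]
    path_algebra_a_inv[OF fin_digraph_axioms ideal_keys] by simp

lemma ideal_sum: "(\<And>x. x \<in> X \<Longrightarrow> f x \<in> I) \<Longrightarrow> sum f X \<in> I"
  by (induction X rule: infinite_finite_induct) (auto simp: ideal_zero ideal_add)

text \<open>Ideals are ring ideals, so scalars have to act through ring elements: rescaling by
  \<open>d / c\<close> is multiplication by that multiple of the trivial path at the source of
  \<open>p\<close>.\<close>

lemma single_in_ideal:
  assumes "p \<in> qpaths Q" "Poly_Mapping.single p c \<in> I" "c \<noteq> 0"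
  shows "Poly_Mapping.single p d \<in> I"
proof -
  let ?e = "(qsource p, [], qsource p)"
  have "?e \<in> qpaths Q"
    using qpath_ends(1)[OF fin_digraph_axioms assms(1)] by (simp add: qpaths_def awalk_Nil_iff)
  then have "pa_mult (Poly_Mapping.single ?e (d / c)) (Poly_Mapping.single p c) \<in> I"
    by (intro ideal_mult_left assms(2)) auto
  moreover have "qconcat ?e p = p"
    by (cases p) (simp add: qconcat_def qsource_def qtarget_def)
  ultimately show ?thesis
    using assms(3) by (simp add: pa_mult_single qsource_def qtarget_def)
qed

text \<open>The product of \<open>u\<close>, \<open>r\<close> and \<open>s\<close> lies in
  \<open>I\<close>, and its terms other than the one from \<open>p\<close> vanish or lie in
  \<open>I\<close>. Hence the remaining term lies in \<open>I\<close>, and its nonzero coefficient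
  can be scaled to 1.\<close>

lemma isolated_term_in_ideal:
  assumes r: "r \<in> I" and p: "p \<in> Poly_Mapping.keys r"
    and u: "u \<in> qpaths Q" "qtarget u = qsource p"
    and s: "s \<in> qpaths Q" "qtarget p = qsource s"
    and others: "\<And>q. q \<in> Poly_Mapping.keys r \<Longrightarrow> q \<noteq> p \<Longrightarrow> qtarget u = qsource q \<Longrightarrow>
      qtarget q = qsource s \<Longrightarrow> path_elt (qconcat (qconcat u q) s) \<in> I"
  shows "path_elt (qconcat (qconcat u p) s) \<in> I"
proof -
  let ?F = "\<lambda>f. pa_mult (pa_mult (path_elt u) f) (path_elt s)"
  let ?c = "Poly_Mapping.lookup r"
  have eq: "?F (Poly_Mapping.single q c) =
      (if qtarget u = qsource q \<and> qtarget q = qsource s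
       then Poly_Mapping.single (qconcat (qconcat u q) s) c else 0)" for q c
    by (auto simp: path_elt_def pa_mult_single) (auto simp: qconcat_def qtarget_def)
  have qp: "q \<in> qpaths Q" if "q \<in> Poly_Mapping.keys r" for q
    using ideal_keys[OF r] that by auto
  have rest: "?F (Poly_Mapping.single q (?c q)) \<in> I"
    if q: "q \<in> Poly_Mapping.keys r - {p}" for q
  proof (cases "qtarget u = qsource q \<and> qtarget q = qsource s")
    case True
    moreover from True have "qconcat (qconcat u q) s \<in> qpaths Q"
      using q u(1) s(1) qp fin_digraph_axioms
      by (intro qconcat_in_qpaths) (auto simp: qconcat_def qtarget_def)
    ultimately show ?thesis
      using others[of q] q single_in_ideal[of _ 1 "?c q", folded path_elt_def] by (simp add: eq)
  next
    case False
    then show ?thesis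
      by (auto simp: eq ideal_zero)
  qed
  have "?F r = ?F (\<Sum>q\<in>Poly_Mapping.keys r. Poly_Mapping.single q (?c q))"
    by (simp add: sum_single_lookup)
  also have "\<dots> = (\<Sum>q\<in>Poly_Mapping.keys r. ?F (Poly_Mapping.single q (?c q)))"
    by (simp only: pa_mult_sum_left pa_mult_sum_right)
  also have "\<dots> = ?F (Poly_Mapping.single p (?c p))
      + (\<Sum>q\<in>Poly_Mapping.keys r - {p}. ?F (Poly_Mapping.single q (?c q)))"
    using p by (simp add: sum.remove)
  finally have "?F (Poly_Mapping.single p (?c p)) =
      ?F r + - (\<Sum>q\<in>Poly_Mapping.keys r - {p}. ?F (Poly_Mapping.single q (?c q)))"
    by simp
  moreover have "(\<Sum>q\<in>Poly_Mapping.keys r - {p}. ?F (Poly_Mapping.single q (?c q))) \<in> I"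
    using rest by (rule ideal_sum)
  moreover have "?F r \<in> I"
    using u(1) s(1) by (intro ideal_mult_right ideal_mult_left r) (auto simp: path_elt_def)
  ultimately have "?F (Poly_Mapping.single p (?c p)) \<in> I"
    by (simp only: ideal_add ideal_uminus)
  then have "Poly_Mapping.single (qconcat (qconcat u p) s) (?c p) \<in> I"
    using u(2) s(2) by (simp add: eq)
  moreover have "qconcat (qconcat u p) s \<in> qpaths Q"
    using p u s qp fin_digraph_axioms
    by (intro qconcat_in_qpaths) (auto simp: qconcat_def qtarget_def)
  ultimately show ?thesis
    using p single_in_ideal[of _ "?c p" 1] by (simp add: path_elt_def in_keys_iff)
qed

section \<open>Arrow words outside the ideal\<close>

text \<open>Endpoints are quantified away to obtain a predicate on words. Those of a nonempty word
  are determined by its arrows, while \<open>[]\<close> is alive as soon as some trivial path lies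
  outside \<open>I\<close>.\<close>

definition alive :: "'a list \<Rightarrow> bool" where
  "alive as \<longleftrightarrow> (\<exists>u v. (u, as, v) \<in> qpaths Q \<and> path_elt (u, as, v) \<notin> I)"

text \<open>The intermediate vertex \<open>v\<close> is absent from the left-hand side and has to be
  supplied whenever the equation is unfolded.\<close>

lemma path_elt_append:
  "path_elt (u, as @ bs, w) = pa_mult (path_elt (u, as, v)) (path_elt (v, bs, w) :: _ \<Rightarrow>\<^sub>0 'k)"
  by (simp add: path_elt_def pa_mult_single qconcat_def qsource_def qtarget_def)

text \<open>\<open>I\<close> is two-sided, so a path with a factor in \<open>I\<close> lies in
  \<open>I\<close> itself.\<close>

lemma factorial_alive: "factorial alive"
  unfolding factorial_def
proof (intro allI impI)
  fix xs ys zs assume "alive (xs @ ys @ zs)"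
  then obtain u u' v' v where
    paths: "(u, xs, u') \<in> qpaths Q" "(u', ys, v') \<in> qpaths Q" "(v', zs, v) \<in> qpaths Q"
    and *: "path_elt (u, xs @ ys @ zs, v) \<notin> I"
    by (auto simp: alive_def qpaths_append_iff[OF fin_digraph_axioms])
  have "path_elt (u', ys, v') \<notin> I"
  proof
    assume "path_elt (u', ys, v') \<in> I"
    then have "path_elt (u', ys @ zs, v) \<in> I"
      unfolding path_elt_append[of _ _ _ _ v']
      by (intro ideal_mult_right) (use paths in \<open>auto simp: path_elt_def\<close>)
    then have "path_elt (u, xs @ ys @ zs, v) \<in> I"
      unfolding path_elt_append[of _ xs _ _ u']
      by (intro ideal_mult_left) (use paths in \<open>auto simp: path_elt_def\<close>)
    with * show False
      by simp
  qed
  with paths show "alive ys"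
    by (auto simp: alive_def)
qed

lemma alive_pairD:
  assumes "alive [a, b]"
  shows "a \<in> arcs Q" "b \<in> arcs Q"
    "pa_mult (arrow_elt Q a) (arrow_elt Q b) \<notin> I"
  using assms
  by (auto simp: alive_def qpaths_def awalk_simps arrow_elt_def path_elt_def pa_mult_single
      qconcat_def qsource_def qtarget_def)

text \<open>An alive two-letter word is a pair of arrows with product outside \<open>I\<close>, so
  condition (S) becomes the uniqueness of neighbours that the lemmas on words assume.\<close>

lemma condition_S_alive_unique:
  assumes "condition_S Q I"
  shows "\<forall>a b c. alive [a, c] \<longrightarrow> alive [b, c] \<longrightarrow> a = b"
    and "\<forall>a b c. alive [c, a] \<longrightarrow> alive [c, b] \<longrightarrow> a = b"
proof -
  show "\<forall>a b c. alive [a, c] \<longrightarrow> alive [b, c] \<longrightarrow> a = b"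
  proof (intro allI impI)
    fix a b c assume *: "alive [a, c]" "alive [b, c]"
    then have "\<exists>\<^sub>\<le>\<^sub>1 d. d \<in> arcs Q \<and> pa_mult (arrow_elt Q d) (arrow_elt Q c) \<notin> I"
      using assms alive_pairD(2) by (simp add: condition_S_def)
    then show "a = b"
      by (rule Uniq_D) (use * alive_pairD in blast)+
  qed
  show "\<forall>a b c. alive [c, a] \<longrightarrow> alive [c, b] \<longrightarrow> a = b"
  proof (intro allI impI)
    fix a b c assume *: "alive [c, a]" "alive [c, b]"
    then have "\<exists>\<^sub>\<le>\<^sub>1 d. d \<in> arcs Q \<and> pa_mult (arrow_elt Q c) (arrow_elt Q d) \<notin> I"
      using assms alive_pairD(1) by (simp add: condition_S_def)
    then show "a = b"
      by (rule Uniq_D) (use * alive_pairD in blast)+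
  qed
qed

lemma path_in_arrow_ideal_power:
  assumes "(u, as, v) \<in> qpaths Q"
  shows "path_elt (u, as, v) \<in>
    arrow_ideal Q [^]\<^bsub>ideals_set (path_algebra Q :: (_ \<Rightarrow>\<^sub>0 'k) ring)\<^esub> length as"
  using assms
\<comment> \<open>Arrows are split off at the right end because natural powers multiply by the base
  on the right.\<close>
proof (induction as arbitrary: v rule: rev_induct)
  case Nil
  \<comment> \<open>The zeroth power is the unit of the monoid of ideals, that is, the whole path
    algebra.\<close>
  then show ?case
    by (simp add: nat_pow_def ideals_set_def path_elt_def)
next
  case (snoc a as)
  then have a: "(u, as, tail Q a) \<in> qpaths Q" "v = head Q a" "a \<in> arcs Q"
    by (auto simp: qpaths_append_iff[OF fin_digraph_axioms] qpaths_arrow_iff[OF fin_digraph_axioms])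
  have "arrow_elt Q ` arcs Q \<subseteq> carrier (path_algebra Q :: (_ \<Rightarrow>\<^sub>0 'k) ring)"
    using fin_digraph_axioms by (auto simp: arrow_elt_def path_elt_def qpaths_arrow_iff)
  then have "(arrow_elt Q a :: _ \<Rightarrow>\<^sub>0 'k) \<in> arrow_ideal Q"
    using J.genideal_self[of "arrow_elt Q ` arcs Q"] a(3) by (auto simp: arrow_ideal_def)
  from ideal_prod.prod[OF snoc.IH[OF a(1)] this, of "path_algebra Q"]
  show ?case
    by (simp add: nat_pow_def ideals_set_def a(2) arrow_elt_def path_elt_append[of _ _ _ _ "tail Q a"])
qed

text \<open>Admissibility places one power \<open>m\<close> of the arrow ideal inside
  \<open>I\<close>. A longer alive word is cut to its prefix of length exactly \<open>m\<close>,
  which would be alive by factoriality and yet lie in that power.\<close>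

lemma admissible_alive_bounded:
  assumes "admissible Q I"
  obtains m where "\<forall>as. alive as \<longrightarrow> length as < m"
proof -
  obtain m :: nat where m: "arrow_ideal Q [^]\<^bsub>ideals_set (path_algebra Q)\<^esub> m \<subseteq> I"
    using assms by (auto simp: admissible_def)
  have "length as < m" if "alive as" for as
  proof (rule ccontr)
    assume "\<not> length as < m"
    then have "alive (take m as)" "length (take m as) = m"
      using factorialD[OF factorial_alive, of "[]" "take m as" "drop m as"] that by auto
    then show False
      using path_in_arrow_ideal_power m by (fastforce simp: alive_def)
  qed
  then show ?thesis
    by (intro that) blast
qed

section \<open>Annihilation of the support of a relation by arrows\<close>

text \<open>A single path surviving multiplication by \<open>a\<close> yields a term
  \<open>q\<close> isolated by \<open>us\<close> and \<open>a\<close>;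
  \<open>isolated_term_in_ideal\<close> then puts the alive path \<open>us @ q @ [a]\<close> into
  \<open>I\<close>.\<close>

lemma support_annihilated_right:
  assumes bound: "\<forall>as. alive as \<longrightarrow> length as < m"
    and S: "condition_S Q I"
    and r: "r \<in> I" "\<And>p. p \<in> Poly_Mapping.keys r \<Longrightarrow> qsource p = v \<and> qtarget p = w"
    and p: "(v, p, w) \<in> Poly_Mapping.keys r"
    and a: "a \<in> arcs Q" "tail Q a = w"
  shows "path_elt (v, p @ [a], head Q a) \<in> I"
proof (rule ccontr)
  assume notin_p: "path_elt (v, p @ [a], head Q a) \<notin> I"
  have walk: "(v, q, w) \<in> qpaths Q" if "(v, q, w) \<in> Poly_Mapping.keys r" for q
    using ideal_keys[OF r(1)] that by auto
  note iffs = qpaths_append_iff[OF fin_digraph_axioms] qpaths_arrow_iff[OF fin_digraph_axioms]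
  have alive_p: "alive (p @ [a])"
    using notin_p walk[OF p] a by (auto simp: alive_def iffs)
  have "p \<in> {q. (v, q, w) \<in> Poly_Mapping.keys r}"
    using p by simp
  from isolating_left_extension[OF factorial_alive condition_S_alive_unique(1)[OF S] bound this alive_p]
  obtain us q where q: "(v, q, w) \<in> Poly_Mapping.keys r" "alive (us @ q @ [a])"
    and others: "\<And>q'. (v, q', w) \<in> Poly_Mapping.keys r \<Longrightarrow> q' \<noteq> q \<Longrightarrow> \<not> alive (us @ q' @ [a])"
    by blast
  obtain u x where x: "(u, us, x) \<in> qpaths Q" "(x, q, w) \<in> qpaths Q"
    and notin: "path_elt (u, us @ q @ [a], head Q a) \<notin> I"
    using q(2) a by (auto simp: alive_def iffs)
  \<comment> \<open>A nonempty \<open>q\<close> fixes its source through its first arrow; for empty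
    \<open>q\<close> both \<open>x\<close> and \<open>v\<close> equal \<open>w\<close>.\<close>
  have "x = v"
    using x(2) walk[OF q(1)] by (cases q) (auto simp: qpaths_def awalk_simps)
  with x have us: "(u, us, v) \<in> qpaths Q"
    by simp
  have "path_elt (qconcat (qconcat (u, us, v) (v, q, w)) (w, [a], head Q a)) \<in> I"
  proof (rule isolated_term_in_ideal[OF r(1) q(1)])
    fix q' assume q': "q' \<in> Poly_Mapping.keys r" "q' \<noteq> (v, q, w)"
    then obtain bs where bs: "q' = (v, bs, w)"
      using r(2)[of q'] by (cases q') (auto simp: qsource_def qtarget_def)
    with q' have "\<not> alive (us @ bs @ [a])" and "(v, bs, w) \<in> qpaths Q"
      using others walk by auto
    then show "path_elt (qconcat (qconcat (u, us, v) q') (w, [a], head Q a)) \<in> I"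
      using us a by (auto simp: bs alive_def iffs qconcat_def qsource_def qtarget_def)
  qed (use us a in \<open>auto simp: iffs qsource_def qtarget_def\<close>)
  with notin show False
    by (simp add: qconcat_def qsource_def qtarget_def)
qed

text \<open>Mirror image of \<open>support_annihilated_right\<close>: the arrow \<open>a\<close>
  stands on the left and the isolating word \<open>us\<close> on the right.\<close>

lemma support_annihilated_left:
  assumes bound: "\<forall>as. alive as \<longrightarrow> length as < m"
    and S: "condition_S Q I"
    and r: "r \<in> I" "\<And>p. p \<in> Poly_Mapping.keys r \<Longrightarrow> qsource p = v \<and> qtarget p = w"
    and p: "(v, p, w) \<in> Poly_Mapping.keys r"
    and a: "a \<in> arcs Q" "head Q a = v"
  shows "path_elt (tail Q a, a # p, w) \<in> I"
proof (rule ccontr)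
  assume notin_p: "path_elt (tail Q a, a # p, w) \<notin> I"
  have walk: "(v, q, w) \<in> qpaths Q" if "(v, q, w) \<in> Poly_Mapping.keys r" for q
    using ideal_keys[OF r(1)] that by auto
  have cons_iff: "(x, a # as, y) \<in> qpaths Q \<longleftrightarrow> x = tail Q a \<and> (v, as, y) \<in> qpaths Q" for x as y
    using a by (auto simp: qpaths_def awalk_simps)
  note iffs = cons_iff qpaths_append_iff[OF fin_digraph_axioms]
  have alive_p: "alive (a # p)"
    using notin_p walk[OF p] by (auto simp: alive_def iffs)
  have "p \<in> {q. (v, q, w) \<in> Poly_Mapping.keys r}"
    using p by simp
  from isolating_right_extension[OF factorial_alive condition_S_alive_unique(2)[OF S] bound this alive_p]
  obtain us q where q: "(v, q, w) \<in> Poly_Mapping.keys r" "alive (a # q @ us)"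
    and others: "\<And>q'. (v, q', w) \<in> Poly_Mapping.keys r \<Longrightarrow> q' \<noteq> q \<Longrightarrow> \<not> alive (a # q' @ us)"
    by blast
  obtain u x where x: "(x, us, u) \<in> qpaths Q" "(v, q, x) \<in> qpaths Q"
    and notin: "path_elt (tail Q a, a # q @ us, u) \<notin> I"
    using q(2) by (auto simp: alive_def iffs)
  have "x = w"
    using x(2) walk[OF q(1)]
    by (cases q rule: rev_cases) (auto simp: qpaths_def awalk_simps)
  with x have us: "(w, us, u) \<in> qpaths Q"
    by simp
  have "path_elt (qconcat (qconcat (tail Q a, [a], v) (v, q, w)) (w, us, u)) \<in> I"
  proof (rule isolated_term_in_ideal[OF r(1) q(1)])
    fix q' assume q': "q' \<in> Poly_Mapping.keys r" "q' \<noteq> (v, q, w)"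
    then obtain bs where bs: "q' = (v, bs, w)"
      using r(2)[of q'] by (cases q') (auto simp: qsource_def qtarget_def)
    with q' have "\<not> alive (a # bs @ us)" and "(v, bs, w) \<in> qpaths Q"
      using others walk by auto
    then show "path_elt (qconcat (qconcat (tail Q a, [a], v) q') (w, us, u)) \<in> I"
      using us by (auto simp: bs alive_def iffs qconcat_def qsource_def qtarget_def)
  qed (use us a in \<open>auto simp: qpaths_arrow_iff[OF fin_digraph_axioms] qsource_def qtarget_def\<close>)
  with notin show False
    by (simp add: qconcat_def qsource_def qtarget_def)
qed

section \<open>Socles of quotients of path algebras\<close>

lemma quot_simps:
  assumes "Poly_Mapping.keys f \<subseteq> qpaths Q" "Poly_Mapping.keys g \<subseteq> qpaths Q"
  shows "(I +>\<^bsub>path_algebra Q\<^esub> f) \<oplus>\<^bsub>path_algebra Q Quot I\<^esub> (I +>\<^bsub>path_algebra Q\<^esub> g)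
      = I +>\<^bsub>path_algebra Q\<^esub> (f + g)"
    and "(I +>\<^bsub>path_algebra Q\<^esub> f) \<otimes>\<^bsub>path_algebra Q Quot I\<^esub> (I +>\<^bsub>path_algebra Q\<^esub> g)
      = I +>\<^bsub>path_algebra Q\<^esub> (pa_mult f g)"
  using ring_hom_add[OF J.rcos_ring_hom, of f g] ring_hom_mult[OF J.rcos_ring_hom, of f g] assms
  by simp_all

lemma zero_quot: "\<zero>\<^bsub>path_algebra Q Quot I\<^esub> = I"
  by (simp add: FactRing_def)

lemma coset_of_ideal: "f \<in> I \<Longrightarrow> I +>\<^bsub>path_algebra Q\<^esub> f = I"
  by (rule J.a_rcos_const)

lemma coset_eqI:
  assumes "Poly_Mapping.keys g \<subseteq> qpaths Q" "f - g \<in> I"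
  shows "I +>\<^bsub>path_algebra Q\<^esub> f = I +>\<^bsub>path_algebra Q\<^esub> g"
proof -
  interpret QR: ring "path_algebra Q Quot I"
    by (rule J.quotient_is_ring)
  have "I +>\<^bsub>path_algebra Q\<^esub> g \<in> carrier (path_algebra Q Quot I)"
    using ring_hom_closed[OF J.rcos_ring_hom, of g] assms(1) by simp
  then have "I \<oplus>\<^bsub>path_algebra Q Quot I\<^esub> (I +>\<^bsub>path_algebra Q\<^esub> g) = I +>\<^bsub>path_algebra Q\<^esub> g"
    by (rule QR.l_zero[unfolded zero_quot])
  then show ?thesis
    using quot_simps(1)[OF ideal_keys[OF assms(2)] assms(1)]
    by (simp only: coset_of_ideal[OF assms(2)] diff_add_cancel)
qed

section \<open>Lines spanned by residue classes of paths\<close>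

text \<open>This is the span over the field of the class of \<open>p\<close>, written through
  representatives because the quotient is a bare ring without scalar action.\<close>

definition line :: "('v, 'a) qpath \<Rightarrow> (('v, 'a) qpath \<Rightarrow>\<^sub>0 'k) set set" where
  "line p = range (\<lambda>c. I +>\<^bsub>path_algebra Q\<^esub> Poly_Mapping.single p c)"

lemma additive_subgroup_line:
  assumes "p \<in> qpaths Q"
  shows "additive_subgroup (line p) (path_algebra Q Quot I)"
proof -
  let ?H = "range (Poly_Mapping.single p) :: (_ \<Rightarrow>\<^sub>0 'k) set"
  have "subgroup ?H (add_monoid (path_algebra Q))"
  proof (rule J.add.subgroupI)
    show "?H \<subseteq> carrier (path_algebra Q)"
      using assms by auto
    show "?H \<noteq> {}"
      by blast
  next
    fix f assume "f \<in> ?H"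
    then obtain c where c: "f = Poly_Mapping.single p c"
      by blast
    have "Poly_Mapping.keys f \<subseteq> qpaths Q"
      using assms by (simp add: c)
    then have "\<ominus>\<^bsub>path_algebra Q\<^esub> f = Poly_Mapping.single p (- c)"
      by (simp add: path_algebra_a_inv[OF fin_digraph_axioms] c single_uminus)
    then show "\<ominus>\<^bsub>path_algebra Q\<^esub> f \<in> ?H"
      by blast
  next
    fix f g assume "f \<in> ?H" "g \<in> ?H"
    then obtain c d where "f = Poly_Mapping.single p c" "g = Poly_Mapping.single p d"
      by blast
    then have "f \<oplus>\<^bsub>path_algebra Q\<^esub> g = Poly_Mapping.single p (c + d)"
      by (simp add: single_add)
    then show "f \<oplus>\<^bsub>path_algebra Q\<^esub> g \<in> ?H"
      by blast
  qed
  then have "subgroup ((+>\<^bsub>path_algebra Q\<^esub>) I ` ?H) (add_monoid (path_algebra Q Quot I))"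
    by (rule ring_hom_ring.img_is_add_subgroup[OF J.rcos_ring_hom_ring])
  then show ?thesis
    by (simp add: additive_subgroup_def line_def image_image)
qed

text \<open>Over a field any nonzero multiple of a class can be rescaled to every other multiple.
  Closure under scalars is the assumption \<open>scale\<close>, so that right and left submodules
  can share the argument.\<close>

lemma additive_subgroup_of_line:
  assumes "additive_subgroup N (path_algebra Q Quot I)" "N \<subseteq> line p"
    and scale: "\<And>c d. I +>\<^bsub>path_algebra Q\<^esub> Poly_Mapping.single p c \<in> N \<Longrightarrow>
      I +>\<^bsub>path_algebra Q\<^esub> Poly_Mapping.single p (c * d) \<in> N"
  shows "N = {\<zero>\<^bsub>path_algebra Q Quot I\<^esub>} \<or> N = line p"
proof (cases "N \<subseteq> {\<zero>\<^bsub>path_algebra Q Quot I\<^esub>}")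
  case True
  then show ?thesis
    using additive_subgroup.zero_closed[OF assms(1)] by auto
next
  case False
  then obtain x where x: "x \<in> N" "x \<noteq> I"
    unfolding zero_quot by blast
  then obtain c where c: "x = I +>\<^bsub>path_algebra Q\<^esub> Poly_Mapping.single p c"
    using assms(2) unfolding line_def by blast
  with x(2) have "c \<noteq> 0"
    using coset_of_ideal[OF ideal_zero] by (intro notI) simp
  then have "I +>\<^bsub>path_algebra Q\<^esub> Poly_Mapping.single p d \<in> N" for d
    using scale[OF x(1)[unfolded c], of "d / c"] by simp
  then have "line p \<subseteq> N"
    unfolding line_def by blast
  then show ?thesis
    using assms(2) by blast
qed

text \<open>Reduces products with an arbitrary element of the path algebra to products with
  multiples of single paths.\<close>

lemma sum_mod_line:
  assumes "\<And>x. x \<in> X \<Longrightarrow> \<exists>d. f x - Poly_Mapping.single p d \<in> I"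
  shows "\<exists>d. sum f X - Poly_Mapping.single p d \<in> I"
  using assms
proof (induction X rule: infinite_finite_induct)
  case (insert x X)
  obtain d where d: "f x - Poly_Mapping.single p d \<in> I"
    using insert.prems[of x] by auto
  obtain e where e: "sum f X - Poly_Mapping.single p e \<in> I"
    using insert.IH insert.prems by blast
  have "sum f (insert x X) - Poly_Mapping.single p (d + e) =
      (f x - Poly_Mapping.single p d) + (sum f X - Poly_Mapping.single p e)"
    using insert(1,2) by (simp add: single_add)
  with ideal_add[OF d e] show ?case
    by metis
qed (rule exI[of _ 0], simp add: ideal_zero)+

lemma coset_in_line:
  assumes "p \<in> qpaths Q" "\<exists>d. f - Poly_Mapping.single p d \<in> I"
  shows "I +>\<^bsub>path_algebra Q\<^esub> f \<in> line p"
  proof -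
  obtain d where "f - Poly_Mapping.single p d \<in> I"
    using assms(2) by blast
  then have "I +>\<^bsub>path_algebra Q\<^esub> f = I +>\<^bsub>path_algebra Q\<^esub> Poly_Mapping.single p d"
    using assms(1) by (intro coset_eqI) auto
  then show ?thesis
    by (auto simp: line_def)
qed

lemma quot_carrierE:
  assumes "x \<in> carrier (path_algebra Q Quot I)"
  obtains f where "Poly_Mapping.keys f \<subseteq> qpaths Q" "x = I +>\<^bsub>path_algebra Q\<^esub> f"
  using assms that by (auto simp: FactRing_def A_RCOSETS_def')

section \<open>Annihilated paths lie in the socle\<close>

text \<open>Modulo \<open>I\<close>, only the trivial path at \<open>v\<close> can act on the path
  without killing it, and it acts by scalars. So the line is a submodule, and it is zero or
  simple.\<close>

lemma annihilated_right_in_socle: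
  assumes p: "(u, as, v) \<in> qpaths Q"
    and ann: "\<And>a. a \<in> arcs Q \<Longrightarrow> tail Q a = v \<Longrightarrow> path_elt (u, as @ [a], head Q a) \<in> I"
  shows "I +>\<^bsub>path_algebra Q\<^esub> path_elt (u, as, v) \<in> right_socle (path_algebra Q Quot I)"
proof -
  let ?p = "(u, as, v)" and ?QR = "path_algebra Q Quot I"
  let ?s = "\<lambda>c. Poly_Mapping.single ?p c"
  have basis: "\<exists>d. pa_mult (?s c) (Poly_Mapping.single q e) - ?s d \<in> I"
    if q: "q \<in> qpaths Q" for c e q
  proof (cases "qsource q = v")
    case True
    then obtain bs w where q_eq: "q = (v, bs, w)"
      by (cases q) (auto simp: qsource_def)
    with q have "(v, bs, w) \<in> qpaths Q"
      by simp
    from qpath_cases[OF fin_digraph_axioms this]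
    consider (trivial) "bs = []" "w = v" |
      (arrow) a bs' where "bs = a # bs'" "a \<in> arcs Q" "tail Q a = v" "(head Q a, bs', w) \<in> qpaths Q"
      by metis
    then show ?thesis
    proof cases
      case trivial
      with trivial q_eq show ?thesis
        by (intro exI[of _ "c * e"])
          (simp add: pa_mult_single qconcat_def qsource_def qtarget_def ideal_zero)
    next
      case (arrow a bs')
      \<comment> \<open>The multiplying path starts with the arrow \<open>a\<close>, and the path
        extended by \<open>a\<close> is already in \<open>I\<close>.\<close>
      have "pa_mult (path_elt (u, as @ [a], head Q a)) (Poly_Mapping.single (head Q a, bs', w) (c * e)) \<in> I"
        by (intro ideal_mult_right ann) (use arrow in auto)
      with arrow q_eq show ?thesis
        by (intro exI[of _ 0])
          (simp add: path_elt_def pa_mult_single qconcat_def qsource_def qtarget_def)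
    qed
  next
    case False
    then show ?thesis
      by (intro exI[of _ 0]) (simp add: pa_mult_single qtarget_def ideal_zero)
  qed
  have mult: "(I +>\<^bsub>path_algebra Q\<^esub> ?s c) \<otimes>\<^bsub>?QR\<^esub> x \<in> line ?p" if x: "x \<in> carrier ?QR" for c x
  proof -
    obtain f where f: "Poly_Mapping.keys f \<subseteq> qpaths Q" "x = I +>\<^bsub>path_algebra Q\<^esub> f"
      using x by (rule quot_carrierE)
    have "\<exists>d. pa_mult (?s c)
        (\<Sum>q\<in>Poly_Mapping.keys f. Poly_Mapping.single q (Poly_Mapping.lookup f q)) - ?s d \<in> I"
      unfolding pa_mult_sum_right by (intro sum_mod_line basis) (use f(1) in auto)
    then show ?thesis
      using coset_in_line[OF p, of "pa_mult (?s c) f"] f p by (simp add: sum_single_lookup quot_simps)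
  qed
  have submodule: "right_submodule (line ?p) ?QR"
    using additive_subgroup_line[OF p] mult by (auto simp: right_submodule_def line_def)
  have "N = {\<zero>\<^bsub>?QR\<^esub>} \<or> N = line ?p" if N: "right_submodule N ?QR" "N \<subseteq> line ?p" for N
  proof (rule additive_subgroup_of_line)
    fix c d assume c: "I +>\<^bsub>path_algebra Q\<^esub> ?s c \<in> N"
    \<comment> \<open>Right multiplication by \<open>d\<close> times this trivial path realises the
      scalar \<open>d\<close> inside the ring.\<close>
    have v: "(v, [], v) \<in> qpaths Q"
      using p by (auto simp: qpaths_def awalk_Nil_iff)
    then have "(I +>\<^bsub>path_algebra Q\<^esub> ?s c) \<otimes>\<^bsub>?QR\<^esub>
        (I +>\<^bsub>path_algebra Q\<^esub> Poly_Mapping.single (v, [], v) d) \<in> N"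
      using N(1) c ring_hom_closed[OF J.rcos_ring_hom, of "Poly_Mapping.single (v, [], v) d"]
      by (auto simp: right_submodule_def)
    then show "I +>\<^bsub>path_algebra Q\<^esub> ?s (c * d) \<in> N"
      using p v by (simp add: quot_simps pa_mult_single qconcat_def qsource_def qtarget_def)
  qed (use N in \<open>auto simp: right_submodule_def\<close>)
  then have "simple_right_submodule (line ?p) ?QR" if "line ?p \<noteq> {\<zero>\<^bsub>?QR\<^esub>}"
    using submodule that by (auto simp: simple_right_submodule_def)
  moreover have "I +>\<^bsub>path_algebra Q\<^esub> path_elt ?p \<in> line ?p"
    by (auto simp: line_def path_elt_def)
  \<comment> \<open>If the line is zero, the class is the neutral element, covered by
    \<open>generate.one\<close>; otherwise it lies in a simple submodule.\<close>
  ultimately show ?thesis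
    using generate.one[of "add_monoid ?QR"] unfolding right_socle_def
    by (cases "line ?p = {\<zero>\<^bsub>?QR\<^esub>}") (auto intro: generate.incl)
qed

text \<open>Dual argument: the multiplying path is decomposed at its last arrow, which meets the
  start of \<open>as\<close>.\<close>

lemma annihilated_left_in_socle:
  assumes p: "(u, as, v) \<in> qpaths Q"
    and ann: "\<And>a. a \<in> arcs Q \<Longrightarrow> head Q a = u \<Longrightarrow> path_elt (tail Q a, a # as, v) \<in> I"
  shows "I +>\<^bsub>path_algebra Q\<^esub> path_elt (u, as, v) \<in> left_socle (path_algebra Q Quot I)"
proof -
  let ?p = "(u, as, v)" and ?QR = "path_algebra Q Quot I"
  let ?s = "\<lambda>c. Poly_Mapping.single ?p c"
  have basis: "\<exists>d. pa_mult (Poly_Mapping.single q e) (?s c) - ?s d \<in> I"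
    if q: "q \<in> qpaths Q" for c e q
  proof (cases "qtarget q = u")
    case True
    then obtain bs w where q_eq: "q = (w, bs, u)"
      by (cases q) (auto simp: qtarget_def)
    with q have "(w, bs, u) \<in> qpaths Q"
      by simp
    from qpath_rev_cases[OF fin_digraph_axioms this]
    consider (trivial) "bs = []" "w = u" |
      (arrow) a bs' where "bs = bs' @ [a]" "a \<in> arcs Q" "head Q a = u" "(w, bs', tail Q a) \<in> qpaths Q"
      by metis
    then show ?thesis
    proof cases
      case trivial
      with trivial q_eq show ?thesis
        by (intro exI[of _ "e * c"])
          (simp add: pa_mult_single qconcat_def qsource_def qtarget_def ideal_zero)
    next
      case (arrow a bs')
      have "pa_mult (Poly_Mapping.single (w, bs', tail Q a) (e * c)) (path_elt (tail Q a, a # as, v)) \<in> I"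
        by (intro ideal_mult_left ann) (use arrow in auto)
      with arrow q_eq show ?thesis
        by (intro exI[of _ 0])
          (simp add: path_elt_def pa_mult_single qconcat_def qsource_def qtarget_def)
    qed
  next
    case False
    then show ?thesis
      by (intro exI[of _ 0]) (simp add: pa_mult_single qsource_def ideal_zero)
  qed
  have mult: "x \<otimes>\<^bsub>?QR\<^esub> (I +>\<^bsub>path_algebra Q\<^esub> ?s c) \<in> line ?p" if x: "x \<in> carrier ?QR" for c x
  proof -
    obtain f where f: "Poly_Mapping.keys f \<subseteq> qpaths Q" "x = I +>\<^bsub>path_algebra Q\<^esub> f"
      using x by (rule quot_carrierE)
    have "\<exists>d. pa_mult
        (\<Sum>q\<in>Poly_Mapping.keys f. Poly_Mapping.single q (Poly_Mapping.lookup f q)) (?s c) - ?s d \<in> I"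
      unfolding pa_mult_sum_left by (intro sum_mod_line basis) (use f(1) in auto)
    then show ?thesis
      using coset_in_line[OF p, of "pa_mult f (?s c)"] f p by (simp add: sum_single_lookup quot_simps)
  qed
  have submodule: "left_submodule (line ?p) ?QR"
    using additive_subgroup_line[OF p] mult by (auto simp: left_submodule_def line_def)
  have "N = {\<zero>\<^bsub>?QR\<^esub>} \<or> N = line ?p" if N: "left_submodule N ?QR" "N \<subseteq> line ?p" for N
  proof (rule additive_subgroup_of_line)
    fix c d assume c: "I +>\<^bsub>path_algebra Q\<^esub> ?s c \<in> N"
    have u: "(u, [], u) \<in> qpaths Q"
      using p by (auto simp: qpaths_def awalk_Nil_iff)
    then have "(I +>\<^bsub>path_algebra Q\<^esub> Poly_Mapping.single (u, [], u) d) \<otimes>\<^bsub>?QR\<^esub>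
        (I +>\<^bsub>path_algebra Q\<^esub> ?s c) \<in> N"
      using N(1) c ring_hom_closed[OF J.rcos_ring_hom, of "Poly_Mapping.single (u, [], u) d"]
      by (auto simp: left_submodule_def)
    \<comment> \<open>Left multiplication produces the coefficient \<open>d * c\<close>;
      commutativity of the field gives the order that \<open>additive_subgroup_of_line\<close>
      expects.\<close>
    then show "I +>\<^bsub>path_algebra Q\<^esub> ?s (c * d) \<in> N"
      using p u
      by (simp add: quot_simps pa_mult_single qconcat_def qsource_def qtarget_def mult.commute)
  qed (use N in \<open>auto simp: left_submodule_def\<close>)
  then have "simple_left_submodule (line ?p) ?QR" if "line ?p \<noteq> {\<zero>\<^bsub>?QR\<^esub>}"
    using submodule that by (auto simp: simple_left_submodule_def)
  moreover have "I +>\<^bsub>path_algebra Q\<^esub> path_elt ?p \<in> line ?p"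
    by (auto simp: line_def path_elt_def)
  ultimately show ?thesis
    using generate.one[of "add_monoid ?QR"] unfolding left_socle_def
    by (cases "line ?p = {\<zero>\<^bsub>?QR\<^esub>}") (auto intro: generate.incl)
qed

end

theorem proposition8:
  fixes Q :: "('v, 'a) pre_digraph"
    and \<rho> :: "(('v, 'a) qpath \<Rightarrow>\<^sub>0 'k::alg_closed_field) set"
    and I :: "(('v, 'a) qpath \<Rightarrow>\<^sub>0 'k) set"
    and r :: "('v, 'a) qpath \<Rightarrow>\<^sub>0 'k"
  assumes "fin_digraph Q"
    and "\<rho> \<subseteq> carrier (path_algebra Q)"
    and "I = genideal (path_algebra Q) \<rho>"
    and "admissible Q I"
    and "condition_S Q I"
    and "r \<in> \<rho>"
    and "uniform_elt Q r"
  shows "(\<exists>p\<in>qpaths Q. r = path_elt p) \<or>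
    (\<forall>p. Poly_Mapping.lookup r p \<noteq> 0 \<longrightarrow>
       I +>\<^bsub>path_algebra Q\<^esub> path_elt p \<in> right_socle (path_algebra Q Quot I) \<and>
       I +>\<^bsub>path_algebra Q\<^esub> path_elt p \<in> left_socle (path_algebra Q Quot I))"
\<comment> \<open>The second alternative is shown in every case: if \<open>r\<close> is a path, its
  class is zero, and zero belongs to both socles.\<close>
proof (intro disjI2 allI impI conjI)
  fix p assume "Poly_Mapping.lookup r p \<noteq> 0"
  interpret R: ring "path_algebra Q :: (('v, 'a) qpath \<Rightarrow>\<^sub>0 'k) ring"
    using assms(1) by (rule ring_path_algebra)
  interpret path_algebra_ideal Q I
    using assms(1,4) by (simp add: path_algebra_ideal_def admissible_def)
  obtain m where bound: "\<forall>as. alive as \<longrightarrow> length as < m"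
    using admissible_alive_bounded[OF assms(4)] by blast
  have r: "r \<in> I"
    using R.genideal_self[OF assms(2)] assms(3,6) by auto
  obtain v w where ends: "\<And>q. q \<in> Poly_Mapping.keys r \<Longrightarrow> qsource q = v \<and> qtarget q = w"
    using uniform_elt_keys[OF assms(7)] by blast
  have "p \<in> Poly_Mapping.keys r"
    using \<open>Poly_Mapping.lookup r p \<noteq> 0\<close> by (simp add: in_keys_iff)
  with ends[OF this] obtain as where p: "p = (v, as, w)" "(v, as, w) \<in> Poly_Mapping.keys r"
    by (cases p) (auto simp: qsource_def qtarget_def)
  then have path: "(v, as, w) \<in> qpaths Q"
    using ideal_keys[OF r] by auto
  show "I +>\<^bsub>path_algebra Q\<^esub> path_elt p \<in> right_socle (path_algebra Q Quot I)"
    unfolding p(1)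
    by (rule annihilated_right_in_socle[OF path],
        rule support_annihilated_right[OF bound assms(5) r ends p(2)])
  show "I +>\<^bsub>path_algebra Q\<^esub> path_elt p \<in> left_socle (path_algebra Q Quot I)"
    unfolding p(1)
    by (rule annihilated_left_in_socle[OF path],
        rule support_annihilated_left[OF bound assms(5) r ends p(2)])
qed

end
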